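(* Let $\mathbb F$ be an algebraically closed field of characteristic $2$ and let $\mathcal H$ be the Heisenberg algebra with basis $x,y,z$ and $[x,y]=z$, $z$ central. Then $\dim_{\mathbb F}H^2_{*_2}(\mathcal H,0)=3$ and $\dim_{\mathbb F}H^2_{*_2}(\mathcal H,z^* )=2$. Moreover (writing only non-zero values on basis elements, and identifying cocycles with their classes): (i) a basis of $H^2_{*_2}(\mathcal H,0)$ is $\{(\varphi_1,\omega_1),(\varphi_2,\omega_2),(0,\omega_3)\}$ with $\varphi_1(y,z)=z$; $\varphi_2(x,z)=z$; $\omega_1(y)=y$; $\omega_2(x)=x$; $\omega_3(z)=z$; (ii) a basis of $H^2_{*_2}(\mathcal H,z^* )$ is $\{(\varphi_1,\omega_1),(\varphi_2,\omega_2)\}$ with $\varphi_1(x,y)=x$; $\varphi_2(x,y)=y$; $\omega_1(y)=y$; $\omega_2(x)=x$.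
   Context: For a linear form $\theta$ on $\mathcal H$, $(\mathcal H,\theta)$ is the restricted Lie algebra $\mathcal H$ with $2$-map $(ax+by+cz)^{[2]}=(a^2\theta(x)+b^2\theta(y)+c^2\theta(z)+ab)z$; $z^*$ is dual to $z$ in the dual basis. $H^2_{*_2}(\mathcal H,\theta)=Z^2_{*_2}/B^2_{*_2}$ is the second restricted cohomology of $L=(\mathcal H,\theta)$ with adjoint coefficients: $C^2_{*_2}(L,L)$ is the set of pairs $(\varphi,\omega)$ with $\varphi:L\times L\to L$ alternating bilinear and $\omega:L\to L$ with $\omega(\lambda u)=\lambda^2\omega(u)$, $\omega(u+v)=\omega(u)+\omega(v)+\varphi(u,v)$ (so $\omega$ is determined by $\varphi$ and its values on $x,y,z$). $Z^2_{*_2}$ consists of those $(\varphi,\omega)$ with $\varphi([u,v],w)+\varphi([u,w],v)+\varphi([v,w],u)+[u,\varphi(v,w)]+[v,\varphi(u,w)]+[w,\varphi(u,v)]=0$ and $\varphi(u,v^{[2]})+[u,\omega(v)]+[\varphi(u,v),v]+\varphi([u,v],v)=0$ for all $u,v,w\in L$. $B^2_{*_2}$ consists of the pairs $(d^1_{CE}\psi,\omega)$ with $\psi:L\to L$ linear, $d^1_{CE}\psi(u,v)=\psi([u,v])+[u,\psi(v)]+[v,\psi(u)]$, $\omega(u)=[\psi(u),u]+\psi(u^{[2]})$. *)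

theory Defs
  imports "Jordan_Normal_Form.VS_Connect" "HOL-Algebra.AbelCoset" "HOL-Library.Product_Plus"
begin

text \<open>Adding \<open>N\<close> in the scalar multiplication makes the result a coset also for the scalar 0.\<close>

definition quotient_module ::
    "('a, 'm, 'e) module_scheme \<Rightarrow> 'm set \<Rightarrow> ('a, 'm set) module" where
  "quotient_module M N =
     \<lparr> carrier = a_rcosets\<^bsub>M\<^esub> N, mult = undefined, one = undefined,
       zero = N, add = (\<lambda>X Y. X <+>\<^bsub>M\<^esub> Y),
       smult = (\<lambda>a X. N <+>\<^bsub>M\<^esub> ((\<lambda>v. a \<odot>\<^bsub>M\<^esub> v) ` X)) \<rparr>"

lemma quotient_module_is_module:
  assumes "Module.module R M" and "submodule R N M"
  shows "Module.module R (quotient_module M N)"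
proof -
  interpret M: Module.module R M by fact
  interpret N: submodule R N M by fact
  have inv: "\<ominus>\<^bsub>M\<^esub> v = (\<ominus>\<^bsub>R\<^esub> \<one>\<^bsub>R\<^esub>) \<odot>\<^bsub>M\<^esub> v" if "v \<in> N" for v
    using that N.subset M.smult_l_minus[of "\<one>\<^bsub>R\<^esub>" v] by auto
  have "subgroup N (add_monoid M)"
    using N.subset by unfold_locales (auto simp: inv simp flip: a_inv_def)
  then interpret N: abelian_subgroup N M
    by (intro abelian_subgroupI3 additive_subgroupI M.abelian_group_axioms)
  let ?Q = "quotient_module M N"
  have Q: "carrier ?Q = a_rcosets\<^bsub>M\<^esub> N" "zero ?Q = N" "X \<oplus>\<^bsub>?Q\<^esub> Y = X <+>\<^bsub>M\<^esub> Y"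
    for X Y by (simp_all add: quotient_module_def)
  have add_Q: "(N +>\<^bsub>M\<^esub> v) \<oplus>\<^bsub>?Q\<^esub> (N +>\<^bsub>M\<^esub> w) = N +>\<^bsub>M\<^esub> (v \<oplus>\<^bsub>M\<^esub> w)"
    if "v \<in> carrier M" "w \<in> carrier M" for v w
    using that by (simp add: Q N.a_rcos_sum)
  have smult_Q: "a \<odot>\<^bsub>?Q\<^esub> (N +>\<^bsub>M\<^esub> v) = N +>\<^bsub>M\<^esub> (a \<odot>\<^bsub>M\<^esub> v)"
    if "a \<in> carrier R" "v \<in> carrier M" for a v
  proof (intro equalityI subsetI)
    fix w assume "w \<in> a \<odot>\<^bsub>?Q\<^esub> (N +>\<^bsub>M\<^esub> v)"
    then obtain n n' where "n \<in> N" "n' \<in> N" "w = n \<oplus>\<^bsub>M\<^esub> a \<odot>\<^bsub>M\<^esub> (n' \<oplus>\<^bsub>M\<^esub> v)"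
      by (auto simp: quotient_module_def set_add_def' a_r_coset_def')
    then have "w = (n \<oplus>\<^bsub>M\<^esub> a \<odot>\<^bsub>M\<^esub> n') \<oplus>\<^bsub>M\<^esub> a \<odot>\<^bsub>M\<^esub> v" "n \<oplus>\<^bsub>M\<^esub> a \<odot>\<^bsub>M\<^esub> n' \<in> N"
      using that N.subset by (auto simp: M.smult_r_distr M.a_assoc subset_iff)
    then show "w \<in> N +>\<^bsub>M\<^esub> (a \<odot>\<^bsub>M\<^esub> v)"
      by (auto simp: a_r_coset_def')
  next
    fix w assume "w \<in> N +>\<^bsub>M\<^esub> (a \<odot>\<^bsub>M\<^esub> v)"
    then obtain n where "n \<in> N" "w = n \<oplus>\<^bsub>M\<^esub> a \<odot>\<^bsub>M\<^esub> v"
      by (auto simp: a_r_coset_def')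
    then show "w \<in> a \<odot>\<^bsub>?Q\<^esub> (N +>\<^bsub>M\<^esub> v)"
      using N.a_rcos_self[OF that(2)] by (auto simp: quotient_module_def set_add_def')
  qed
  have cosets: "(\<exists>v \<in> carrier M. X = N +>\<^bsub>M\<^esub> v) \<longleftrightarrow> X \<in> carrier ?Q" for X
    by (auto simp: Q A_RCOSETS_def')
  have N_coset: "zero ?Q = N +>\<^bsub>M\<^esub> \<zero>\<^bsub>M\<^esub>"
    using N.subset by (simp add: Q M.a_coset_add_zero)
  have neg: "\<exists>Y \<in> carrier ?Q. (N +>\<^bsub>M\<^esub> v) \<oplus>\<^bsub>?Q\<^esub> Y = N +>\<^bsub>M\<^esub> \<zero>\<^bsub>M\<^esub>"
    if "v \<in> carrier M" for v
    using that cosets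
    by (intro bexI[of _ "N +>\<^bsub>M\<^esub> (\<ominus>\<^bsub>M\<^esub> v)"]) (auto simp: add_Q M.r_neg)
  show ?thesis
    by (intro module_criteria M.R.is_cring)
      (use neg in \<open>auto simp: N_coset add_Q smult_Q M.a_ac M.smult_l_distr M.smult_r_distr
        M.smult_assoc1 simp flip: cosets\<close>)
qed

text \<open>Restricted Lie algebras over a field of characteristic 2, and their second restricted
  cohomology with adjoint coefficients. The map \<open>sq\<close> is the 2-map.\<close>

locale restricted_lie_algebra_2 = vector_space scale
  for scale :: "'a::field \<Rightarrow> 'v::ab_group_add \<Rightarrow> 'v" +
  fixes br :: "'v \<Rightarrow> 'v \<Rightarrow> 'v" and sq :: "'v \<Rightarrow> 'v"
  assumes char_2: "CHAR('a) = 2"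
    and br_linear_left: "\<And>v. Vector_Spaces.linear scale scale (\<lambda>u. br u v)"
    and br_linear_right: "\<And>u. Vector_Spaces.linear scale scale (br u)"
    and br_self: "\<And>u. br u u = 0"
    and jacobi: "\<And>u v w. br u (br v w) + br v (br w u) + br w (br u v) = 0"
    and sq_scale: "\<And>c u. sq (scale c u) = scale (c\<^sup>2) (sq u)"
    and sq_add: "\<And>u v. sq (u + v) = sq u + sq v + br u v"
    and br_sq: "\<And>u v. br u (sq v) = br (br u v) v"
begin

definition cochains2 :: "('a, ('v \<Rightarrow> 'v \<Rightarrow> 'v) \<times> ('v \<Rightarrow> 'v)) module" where
  "cochains2 =
     \<lparr> carrier = {(\<phi>, \<omega>).
         (\<forall>v. Vector_Spaces.linear scale scale (\<lambda>u. \<phi> u v)) \<and>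
         (\<forall>u. Vector_Spaces.linear scale scale (\<phi> u)) \<and>
         (\<forall>u. \<phi> u u = 0) \<and>
         (\<forall>c u. \<omega> (scale c u) = scale (c\<^sup>2) (\<omega> u)) \<and>
         (\<forall>u v. \<omega> (u + v) = \<omega> u + \<omega> v + \<phi> u v)},
       mult = undefined, one = undefined,
       zero = (\<lambda>u v. 0, \<lambda>u. 0),
       add = (\<lambda>(\<phi>, \<omega>) (\<phi>', \<omega>'). (\<lambda>u v. \<phi> u v + \<phi>' u v, \<lambda>u. \<omega> u + \<omega>' u)),
       smult = (\<lambda>c (\<phi>, \<omega>). (\<lambda>u v. scale c (\<phi> u v), \<lambda>u. scale c (\<omega> u))) \<rparr>"

definition cocycles2 :: "(('v \<Rightarrow> 'v \<Rightarrow> 'v) \<times> ('v \<Rightarrow> 'v)) set" where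
  "cocycles2 = {(\<phi>, \<omega>) \<in> carrier cochains2.
     (\<forall>u v w. \<phi> (br u v) w + \<phi> (br u w) v + \<phi> (br v w) u
        + br u (\<phi> v w) + br v (\<phi> u w) + br w (\<phi> u v) = 0) \<and>
     (\<forall>u v. \<phi> u (sq v) + br u (\<omega> v) + br (\<phi> u v) v + \<phi> (br u v) v = 0)}"

definition d1_CE :: "('v \<Rightarrow> 'v) \<Rightarrow> 'v \<Rightarrow> 'v \<Rightarrow> 'v" where
  "d1_CE \<psi> u v = \<psi> (br u v) + br u (\<psi> v) + br v (\<psi> u)"

definition coboundaries2 :: "(('v \<Rightarrow> 'v \<Rightarrow> 'v) \<times> ('v \<Rightarrow> 'v)) set" where
  "coboundaries2 = {(d1_CE \<psi>, \<lambda>u. br (\<psi> u) u + \<psi> (sq u)) | \<psi>.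
     Vector_Spaces.linear scale scale \<psi>}"

definition H2 :: "('a, (('v \<Rightarrow> 'v \<Rightarrow> 'v) \<times> ('v \<Rightarrow> 'v)) set) module" where
  "H2 = quotient_module (cochains2\<lparr>carrier := cocycles2\<rparr>) coboundaries2"

definition H2_class ::
    "('v \<Rightarrow> 'v \<Rightarrow> 'v) \<times> ('v \<Rightarrow> 'v) \<Rightarrow> (('v \<Rightarrow> 'v \<Rightarrow> 'v) \<times> ('v \<Rightarrow> 'v)) set" where
  "H2_class c = coboundaries2 +>\<^bsub>cochains2\<^esub> c"

lemma linear_iff_2:
  "Vector_Spaces.linear scale scale f \<longleftrightarrow>
     (\<forall>u v. f (u + v) = f u + f v) \<and> (\<forall>k u. f (scale k u) = scale k (f u))"
  using vector_space_axioms
  by (auto simp: Vector_Spaces.linear_def module_hom_def module_hom_axioms_def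
      vector_space_def Modules.module_def)

lemma double: "u + u = (0 :: 'v)"
proof -
  have "(2 :: 'a) = 0"
    using char_2 by (metis of_nat_CHAR of_nat_numeral)
  then have "scale (1 + 1) u = 0"
    by simp
  then show ?thesis
    unfolding scale_left_distrib by simp
qed

lemma double_left: "u + (u + v) = (v :: 'v)"
  using double[of u] by (metis add.assoc add_0)

lemma br_simps:
  "br (u + u') v = br u v + br u' v" "br u (v + v') = br u v + br u v'"
  "br (scale k u) v = scale k (br u v)" "br u (scale k v) = scale k (br u v)"
  "br 0 v = 0" "br u 0 = 0"
proof -
  show add: "br (u + u') v = br u v + br u' v" "br u (v + v') = br u v + br u v'"
    and "br (scale k u) v = scale k (br u v)" "br u (scale k v) = scale k (br u v)"
    for u u' v v' k
    using br_linear_left br_linear_right by (auto simp: linear_iff_2)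
  show "br 0 v = 0" "br u 0 = 0"
    using add(1)[of 0 0 v] add(2)[of u 0 0] by auto
qed

lemma br_commute: "br u v = br v u"
proof -
  have "br u v + br v u = 0"
    using br_self[of "u + v"] unfolding br_simps by (simp add: br_self add.commute)
  then have "br u v + br v u = br u v + br u v" by (simp only: double)
  then show ?thesis by (simp only: add_left_cancel)
qed

lemma cochains2_module: "Module.module class_ring cochains2"
proof -
  have "\<forall>c \<in> carrier cochains2. \<exists>c' \<in> carrier cochains2. c \<oplus>\<^bsub>cochains2\<^esub> c' = \<zero>\<^bsub>cochains2\<^esub>"
  proof
    fix c assume "c \<in> carrier cochains2"
    moreover have "c \<oplus>\<^bsub>cochains2\<^esub> c = \<zero>\<^bsub>cochains2\<^esub>"
      by (cases c) (simp add: cochains2_def double)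
    ultimately show "\<exists>c' \<in> carrier cochains2. c \<oplus>\<^bsub>cochains2\<^esub> c' = \<zero>\<^bsub>cochains2\<^esub>" ..
  qed
  then show ?thesis
    by (intro module_criteria)
      (auto simp: class_cring.is_cring cochains2_def linear_iff_2 add_ac mult_ac
        scale_right_distrib scale_left_distrib)
qed

lemma coboundaries2_subset: "coboundaries2 \<subseteq> cocycles2"
proof
  fix c assume "c \<in> coboundaries2"
  then obtain \<psi> where c: "c = (d1_CE \<psi>, \<lambda>u. br (\<psi> u) u + \<psi> (sq u))"
    and "Vector_Spaces.linear scale scale \<psi>"
    by (auto simp: coboundaries2_def)
  then have \<psi>: "\<psi> (u + v) = \<psi> u + \<psi> v" "\<psi> (scale k u) = scale k (\<psi> u)" for u v k
    by (auto simp: linear_iff_2)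
  have \<psi>0: "\<psi> 0 = 0"
    using \<psi>(1)[of 0 0] by simp
  note dd = double double_left
  have 1: "c \<in> carrier cochains2"
    unfolding c cochains2_def d1_CE_def
    by (auto simp: linear_iff_2 \<psi> \<psi>0 br_simps br_self sq_scale sq_add scale_right_distrib
        add_ac dd power2_eq_square br_commute)
  define J where "J u v w = br u (br v w) + br v (br w u) + br w (br u v)" for u v w
  have J: "J u v w = 0" for u v w
    by (simp add: J_def jacobi)
  have 2: "d1_CE \<psi> (br u v) w + d1_CE \<psi> (br u w) v + d1_CE \<psi> (br v w) u
      + br u (d1_CE \<psi> v w) + br v (d1_CE \<psi> u w) + br w (d1_CE \<psi> u v) = 0" for u v w
  proof -
    have "d1_CE \<psi> (br u v) w + d1_CE \<psi> (br u w) v + d1_CE \<psi> (br v w) u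
        + br u (d1_CE \<psi> v w) + br v (d1_CE \<psi> u w) + br w (d1_CE \<psi> u v)
      = \<psi> (J u v w) + J u v (\<psi> w) + J u w (\<psi> v) + J v w (\<psi> u)"
      unfolding d1_CE_def J_def by (simp add: \<psi> br_simps br_commute add_ac dd)
    then show ?thesis
      by (simp add: J \<psi>0)
  qed
  have 3: "d1_CE \<psi> u (sq v) + br u (br (\<psi> v) v + \<psi> (sq v)) + br (d1_CE \<psi> u v) v
      + d1_CE \<psi> (br u v) v = 0" for u v
  proof -
    have "d1_CE \<psi> u (sq v) + br u (br (\<psi> v) v + \<psi> (sq v)) + br (d1_CE \<psi> u v) v
        + d1_CE \<psi> (br u v) v = J u v (\<psi> v)"
      unfolding d1_CE_def J_def br_commute[of "sq v"] br_sq
      by (simp add: \<psi> br_simps br_commute add_ac dd)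
    then show ?thesis
      by (simp add: J)
  qed
  show "c \<in> cocycles2"
    using 1 2 3 by (simp add: cocycles2_def c)
qed

lemma cocycles2_submodule: "submodule class_ring cocycles2 cochains2"
proof (intro submodule.intro cochains2_module)
  show "cocycles2 \<subseteq> carrier cochains2"
    by (auto simp: cocycles2_def)
  show "\<zero>\<^bsub>cochains2\<^esub> \<in> cocycles2"
    by (auto simp: cocycles2_def cochains2_def linear_iff_2 br_simps)
  show "c \<oplus>\<^bsub>cochains2\<^esub> c' \<in> cocycles2" if cc': "c \<in> cocycles2" "c' \<in> cocycles2" for c c'
  proof -
    obtain \<phi> \<omega> \<phi>' \<omega>' where c: "c = (\<phi>, \<omega>)" "c' = (\<phi>', \<omega>')"
      by (cases c, cases c') auto
    have e1: "(\<phi> (br u v) w + \<phi>' (br u v) w) + (\<phi> (br u w) v + \<phi>' (br u w) v)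
        + (\<phi> (br v w) u + \<phi>' (br v w) u) + br u (\<phi> v w + \<phi>' v w) + br v (\<phi> u w + \<phi>' u w)
        + br w (\<phi> u v + \<phi>' u v)
      = (\<phi> (br u v) w + \<phi> (br u w) v + \<phi> (br v w) u
        + br u (\<phi> v w) + br v (\<phi> u w) + br w (\<phi> u v))
      + (\<phi>' (br u v) w + \<phi>' (br u w) v + \<phi>' (br v w) u
        + br u (\<phi>' v w) + br v (\<phi>' u w) + br w (\<phi>' u v))" for u v w
      by (simp add: br_simps add_ac)
    have e2: "(\<phi> u (sq v) + \<phi>' u (sq v)) + br u (\<omega> v + \<omega>' v)
        + br (\<phi> u v + \<phi>' u v) v + (\<phi> (br u v) v + \<phi>' (br u v) v)
      = (\<phi> u (sq v) + br u (\<omega> v) + br (\<phi> u v) v + \<phi> (br u v) v)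
      + (\<phi>' u (sq v) + br u (\<omega>' v) + br (\<phi>' u v) v + \<phi>' (br u v) v)" for u v
      by (simp add: br_simps add_ac)
    have "c \<oplus>\<^bsub>cochains2\<^esub> c' \<in> carrier cochains2"
      using cc' by (intro abelian_monoid.a_closed abelian_group.axioms(1)
          Module.module.axioms(2)[OF cochains2_module]) (auto simp: cocycles2_def)
    moreover have "c \<oplus>\<^bsub>cochains2\<^esub> c' = (\<lambda>u v. \<phi> u v + \<phi>' u v, \<lambda>u. \<omega> u + \<omega>' u)"
      by (simp add: c cochains2_def)
    ultimately show ?thesis
      using cc' by (auto simp: c cocycles2_def e1 e2)
  qed
  show "k \<odot>\<^bsub>cochains2\<^esub> c \<in> cocycles2" if c: "c \<in> cocycles2" for k c
  proof -
    obtain \<phi> \<omega> where c': "c = (\<phi>, \<omega>)"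
      by (cases c)
    have "k \<odot>\<^bsub>cochains2\<^esub> c \<in> carrier cochains2"
      using c by (intro Module.module.smult_closed[OF cochains2_module]) (auto simp: cocycles2_def)
    moreover have "k \<odot>\<^bsub>cochains2\<^esub> c = (\<lambda>u v. scale k (\<phi> u v), \<lambda>u. scale k (\<omega> u))"
      by (simp add: c' cochains2_def)
    ultimately show ?thesis
      using c by (simp add: c' cocycles2_def br_simps flip: scale_right_distrib)
  qed
qed

lemma coboundaries2_submodule:
  "submodule class_ring coboundaries2 (cochains2\<lparr>carrier := cocycles2\<rparr>)"
proof (intro submodule.intro)
  show "Module.module class_ring (cochains2\<lparr>carrier := cocycles2\<rparr>)"
    by (intro LinearCombinations.module.submodule_is_module cochains2_module cocycles2_submodule)
  show "coboundaries2 \<subseteq> carrier (cochains2\<lparr>carrier := cocycles2\<rparr>)"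
    using coboundaries2_subset by simp
  have I: "(\<phi>, \<omega>) \<in> coboundaries2"
    if "\<And>u v. \<psi> (u + v) = \<psi> u + \<psi> v" "\<And>k u. \<psi> (scale k u) = scale k (\<psi> u)"
      "\<And>u v. \<phi> u v = d1_CE \<psi> u v" "\<And>u. \<omega> u = br (\<psi> u) u + \<psi> (sq u)" for \<psi> \<phi> \<omega>
    using that unfolding coboundaries2_def linear_iff_2
    by (auto simp: fun_eq_iff intro!: exI[of _ \<psi>])
  show "\<zero>\<^bsub>cochains2\<lparr>carrier := cocycles2\<rparr>\<^esub> \<in> coboundaries2"
    by (simp add: cochains2_def, rule I[of "\<lambda>_. 0"]) (auto simp: d1_CE_def br_simps)
  show "c \<oplus>\<^bsub>cochains2\<lparr>carrier := cocycles2\<rparr>\<^esub> c' \<in> coboundaries2"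
    if "c \<in> coboundaries2" "c' \<in> coboundaries2" for c c'
  proof -
    from that obtain \<psi> \<psi>' where
      "c = (d1_CE \<psi>, \<lambda>u. br (\<psi> u) u + \<psi> (sq u))"
      "c' = (d1_CE \<psi>', \<lambda>u. br (\<psi>' u) u + \<psi>' (sq u))"
      "Vector_Spaces.linear scale scale \<psi>" "Vector_Spaces.linear scale scale \<psi>'"
      by (auto simp: coboundaries2_def)
    then show ?thesis
      by (simp add: cochains2_def, intro I[of "\<lambda>u. \<psi> u + \<psi>' u"])
        (auto simp: linear_iff_2 d1_CE_def br_simps add_ac scale_right_distrib)
  qed
  show "k \<odot>\<^bsub>cochains2\<lparr>carrier := cocycles2\<rparr>\<^esub> c \<in> coboundaries2"
    if "c \<in> coboundaries2" for k c
  proof -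
    from that obtain \<psi> where
      "c = (d1_CE \<psi>, \<lambda>u. br (\<psi> u) u + \<psi> (sq u))" "Vector_Spaces.linear scale scale \<psi>"
      by (auto simp: coboundaries2_def)
    then show ?thesis
      by (simp add: cochains2_def, intro I[of "\<lambda>u. scale k (\<psi> u)"])
        (auto simp: linear_iff_2 d1_CE_def br_simps scale_right_distrib mult_ac)
  qed
qed

lemma H2_vectorspace: "vectorspace class_ring H2"
  unfolding H2_def
  by (intro vectorspace.intro quotient_module_is_module coboundaries2_submodule
      submodule.module[OF coboundaries2_submodule]) (rule class_field.field_axioms)

end

text \<open>The triple \<open>(a, b, c)\<close> stands for \<open>a x + b y + c z\<close>.\<close>

type_synonym 'a heis = "'a \<times> 'a \<times> 'a"

definition heis_x :: "'a::field heis" where "heis_x = (1, 0, 0)"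
definition heis_y :: "'a::field heis" where "heis_y = (0, 1, 0)"
definition heis_z :: "'a::field heis" where "heis_z = (0, 0, 1)"

fun heis_scale :: "'a::field \<Rightarrow> 'a heis \<Rightarrow> 'a heis" where
  "heis_scale k (a, b, c) = (k * a, k * b, k * c)"

fun heis_bracket :: "'a::field heis \<Rightarrow> 'a heis \<Rightarrow> 'a heis" where
  "heis_bracket (a, b, c) (a', b', c') = heis_scale (a * b' - b * a') heis_z"

fun heis_sq :: "('a::field heis \<Rightarrow> 'a) \<Rightarrow> 'a heis \<Rightarrow> 'a heis" where
  "heis_sq \<theta> (a, b, c) =
     heis_scale (a\<^sup>2 * \<theta> heis_x + b\<^sup>2 * \<theta> heis_y + c\<^sup>2 * \<theta> heis_z + a * b) heis_z"

fun heis_z_dual :: "'a::field heis \<Rightarrow> 'a" where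
  "heis_z_dual (a, b, c) = c"

abbreviation heis_H2 where
  "heis_H2 \<theta> \<equiv> restricted_lie_algebra_2.H2 heis_scale heis_bracket (heis_sq \<theta>)"

abbreviation heis_H2_class where
  "heis_H2_class \<theta> \<equiv> restricted_lie_algebra_2.H2_class heis_scale heis_bracket (heis_sq \<theta>)"

text \<open>The 2-cochain \<open>(\<phi>, \<omega>)\<close> with \<open>\<phi>(x,y) = p\<close>, \<open>\<phi>(x,z) = q\<close>, \<open>\<phi>(y,z) = r\<close> and
  \<open>\<omega>(x) = d\<close>, \<open>\<omega>(y) = e\<close>, \<open>\<omega>(z) = f\<close>. Expanding \<open>\<omega>(a x + b y + c z)\<close> with the additivity
  defect \<open>\<phi>\<close> produces the mixed terms below.\<close>

definition heis_cochain ::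
    "'a::field heis \<Rightarrow> 'a heis \<Rightarrow> 'a heis \<Rightarrow> 'a heis \<Rightarrow> 'a heis \<Rightarrow> 'a heis \<Rightarrow>
     ('a heis \<Rightarrow> 'a heis \<Rightarrow> 'a heis) \<times> ('a heis \<Rightarrow> 'a heis)" where
  "heis_cochain p q r d e f =
     (\<lambda>(a, b, c) (a', b', c').
        heis_scale (a * b' - b * a') p + heis_scale (a * c' - c * a') q
        + heis_scale (b * c' - c * b') r,
      \<lambda>(a, b, c).
        heis_scale (a\<^sup>2) d + heis_scale (b\<^sup>2) e + heis_scale (c\<^sup>2) f
        + heis_scale (a * b) p + heis_scale (a * c) q + heis_scale (b * c) r)"

lemma heis_vector_space: "vector_space (heis_scale :: 'a::field \<Rightarrow> _)"
  by standard (auto simp: algebra_simps)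

lemma heis_linear_iff:
  "Vector_Spaces.linear heis_scale heis_scale f \<longleftrightarrow>
     (\<forall>u v. f (u + v) = f u + f v) \<and> (\<forall>k u. f (heis_scale k u) = heis_scale k (f u))"
  for f :: "'a::field heis \<Rightarrow> 'a heis"
  using heis_vector_space[where 'a='a]
  by (auto simp: Vector_Spaces.linear_def module_hom_def module_hom_axioms_def
      vector_space_def Modules.module_def)

lemma char_2_double: "CHAR('a::field) = 2 \<Longrightarrow> (a::'a) + a = 0"
  by (metis mult_2 mult_zero_left of_nat_CHAR of_nat_numeral)

lemma char_2_minus: "CHAR('a::field) = 2 \<Longrightarrow> - (a::'a) = a"
  by (metis add.inverse_unique char_2_double)

lemma heis_restricted_lie_algebra:
  assumes "CHAR('a::field) = 2"
  shows "restricted_lie_algebra_2 heis_scale heis_bracket (heis_sq (\<theta> :: 'a heis \<Rightarrow> 'a))"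
proof -
  note m = char_2_minus[OF assms]
  have d: "a - b = a + b" for a b :: 'a
    by (metis diff_conv_add_uminus m)
  have dd: "a + (a + b) = b" for a b :: 'a
    using char_2_double[OF assms] by (metis add.assoc add_0)
  show ?thesis
    by (intro restricted_lie_algebra_2.intro restricted_lie_algebra_2_axioms.intro
        heis_vector_space)
      (auto simp: assms heis_linear_iff heis_z_def algebra_simps power2_eq_square d dd
        char_2_double[OF assms] zero_prod_def)
qed

lemma heis_cochain_unique:
  assumes "CHAR('a::field) = 2"
  shows "(\<phi>, \<omega>) \<in> carrier (restricted_lie_algebra_2.cochains2 heis_scale) \<and>
      \<phi> heis_x heis_y = p \<and> \<phi> heis_x heis_z = q \<and> \<phi> heis_y heis_z = r \<and>
      \<omega> heis_x = d \<and> \<omega> heis_y = e \<and> \<omega> heis_z = f \<longleftrightarrow>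
    (\<phi>, \<omega>) = heis_cochain p q r d e (f :: 'a heis)"
    (is "?L \<longleftrightarrow> ?R")
proof -
  interpret restricted_lie_algebra_2 heis_scale heis_bracket "heis_sq (\<lambda>_. 0 :: 'a)"
    by (rule heis_restricted_lie_algebra[OF assms])
  note m = char_2_minus[OF assms]
  have dm: "a - b = a + b" for a b :: 'a
    by (metis diff_conv_add_uminus m)
  have dd: "a + (a + b) = b" for a b :: 'a
    using char_2_double[OF assms] by (metis add.assoc add_0)
  have dl: "u + u = 0" for u :: "'a heis"
    by (cases u) (simp add: char_2_double[OF assms] zero_prod_def)
  show ?thesis
  proof
    assume L: ?L
    have l: "\<phi> (u + u') v = \<phi> u v + \<phi> u' v" "\<phi> (heis_scale k u) v = heis_scale k (\<phi> u v)"
      "\<phi> u (v + v') = \<phi> u v + \<phi> u v'" "\<phi> u (heis_scale k v) = heis_scale k (\<phi> u v)"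
      "\<phi> u u = 0" "\<omega> (heis_scale k u) = heis_scale (k\<^sup>2) (\<omega> u)"
      "\<omega> (u + v) = \<omega> u + \<omega> v + \<phi> u v" for u u' v v' k
      using L unfolding cochains2_def heis_linear_iff by (simp_all del: split_paired_All)
    have b: "(a, b, c) = heis_scale a heis_x + heis_scale b heis_y + heis_scale c heis_z"
      for a b c :: 'a
      by (simp add: heis_x_def heis_y_def heis_z_def)
    have sym: "\<phi> v u = \<phi> u v" for u v
    proof -
      have "\<phi> u v + \<phi> v u = 0" using l(5)[of "u + v"] unfolding l(1,3)
        by (simp add: l(5) add.commute)
      then have "\<phi> u v + \<phi> v u = \<phi> u v + \<phi> u v" by (simp only: dl)
      then show ?thesis by (simp only: add_left_cancel)
    qed
    have xyz: "\<phi> heis_x heis_y = p" "\<phi> heis_x heis_z = q" "\<phi> heis_y heis_z = r"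
        "\<omega> heis_x = d" "\<omega> heis_y = e" "\<omega> heis_z = f"
      using L by auto
    have "\<phi> = fst (heis_cochain p q r d e f)"
    proof (intro ext)
      fix u v :: "'a heis"
      obtain a b c a' b' c' where uv: "u = (a, b, c)" "v = (a', b', c')"
        by (cases u, cases v) auto
      have "\<phi> u v = heis_scale a (heis_scale b' p) + heis_scale a (heis_scale c' q)
          + heis_scale b (heis_scale a' p) + heis_scale b (heis_scale c' r)
          + heis_scale c (heis_scale a' q) + heis_scale c (heis_scale b' r)"
        unfolding uv b[of a b c] b[of a' b' c']
        using xyz sym[of heis_x heis_y] sym[of heis_x heis_z] sym[of heis_y heis_z]
        by (simp add: l scale_right_distrib ac_simps)
      then show "\<phi> u v = fst (heis_cochain p q r d e f) u v"
        by (cases p; cases q; cases r)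
          (simp add: heis_cochain_def uv algebra_simps dm)
    qed
    moreover have "\<omega> = snd (heis_cochain p q r d e f)"
    proof (intro ext)
      fix u :: "'a heis"
      obtain a b c where u: "u = (a, b, c)"
        by (cases u) auto
      have "\<omega> u = heis_scale (a\<^sup>2) d + heis_scale (b\<^sup>2) e + heis_scale (c\<^sup>2) f
          + heis_scale a (heis_scale b p) + heis_scale a (heis_scale c q)
          + heis_scale b (heis_scale c r)"
        unfolding u b[of a b c]
        using xyz by (simp add: l scale_right_distrib ac_simps)
      then show "\<omega> u = snd (heis_cochain p q r d e f) u"
        by (simp add: heis_cochain_def u)
    qed
    ultimately show ?R by (simp add: prod_eq_iff)
  next
    assume R: ?R
    obtain p1 p2 p3 q1 q2 q3 r1 r2 r3 where pq: "p = (p1, p2, p3)" "q = (q1, q2, q3)" "r = (r1, r2, r3)"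
      by (cases p, cases q, cases r) auto
    show ?L
      using R by (cases d; cases e; cases f)
        (auto simp: pq cochains2_def heis_cochain_def heis_linear_iff heis_x_def heis_y_def
          heis_z_def zero_prod_def algebra_simps power2_eq_square dm dd char_2_double[OF assms])
  qed
qed

end

theory Submission
  imports Defs
begin

text \<open>Writing a cochain through its values \<open>\<phi>(x,y) = p\<close>, \<open>\<phi>(x,z) = q\<close>, \<open>\<phi>(y,z) = r\<close>, \<open>\<omega>(x) = d\<close>,
  \<open>\<omega>(y) = e\<close>, \<open>\<omega>(z) = f\<close>, with coordinates indexed by 1, 2, 3, the cocycle and coboundary conditions
  become linear equations. If \<open>\<theta>(x) = \<theta>(y) = 0\<close>, a cocycle is a coboundary iff the functionals
  \<open>p\<^sub>1 + r\<^sub>3\<close>, \<open>p\<^sub>2 + q\<^sub>3\<close> and, when \<open>\<theta>(z) = 0\<close>, also \<open>f\<^sub>3\<close> vanish on it. These functionals are dual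
  to the claimed cocycles, whose classes are therefore a basis of the quotient.\<close>

section \<open>Bases of images and quotients from dual functionals\<close>

text \<open>By \<open>kernel\<close>, \<open>T v\<close> is determined by the scalars
  \<open>F i v\<close>. Hence \<open>v\<close> has the same image as the combination of the
  \<open>c i\<close> with coefficients \<open>F i v\<close>, so the images span; applying
  \<open>F i\<close> to a vanishing combination returns its coefficient at \<open>i\<close>, so they
  are independent.\<close>

lemma (in linear_map) basis_image_if_dual_functionals:
  assumes I: "finite I" and c: "c \<in> I \<rightarrow> carrier V" and surj: "T ` carrier V = carrier W"
    and F: "\<And>i v. i \<in> I \<Longrightarrow> v \<in> carrier V \<Longrightarrow> F i v \<in> carrier K"
    and F_add: "\<And>i v w. i \<in> I \<Longrightarrow> v \<in> carrier V \<Longrightarrow> w \<in> carrier V \<Longrightarrow>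
      F i (v \<oplus>\<^bsub>V\<^esub> w) = F i v \<oplus>\<^bsub>K\<^esub> F i w"
    and F_smult: "\<And>i k v. i \<in> I \<Longrightarrow> k \<in> carrier K \<Longrightarrow> v \<in> carrier V \<Longrightarrow>
      F i (k \<odot>\<^bsub>V\<^esub> v) = k \<otimes>\<^bsub>K\<^esub> F i v"
    and dual: "\<And>i j. i \<in> I \<Longrightarrow> j \<in> I \<Longrightarrow> F i (c j) = (if i = j then \<one>\<^bsub>K\<^esub> else \<zero>\<^bsub>K\<^esub>)"
    and kernel: "\<And>v. v \<in> carrier V \<Longrightarrow> T v = \<zero>\<^bsub>W\<^esub> \<longleftrightarrow> (\<forall>i\<in>I. F i v = \<zero>\<^bsub>K\<^esub>)"
  shows "inj_on (\<lambda>i. T (c i)) I" and "W.basis ((\<lambda>i. T (c i)) ` I)"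
proof -
  define L where "L a J = (\<Oplus>\<^bsub>V\<^esub>j\<in>J. a j \<odot>\<^bsub>V\<^esub> c j)" for a J
  have cV[simp]: "c i \<in> carrier V" if "i \<in> I" for i using c that by auto
  have TW[simp]: "T v \<in> carrier W" if "v \<in> carrier V" for v using surj that by auto
  note [simp] = F
  have T_add: "T (v \<oplus>\<^bsub>V\<^esub> w) = T v \<oplus>\<^bsub>W\<^esub> T w" if "v \<in> carrier V" "w \<in> carrier V" for v w
    using f_hom that by (auto simp: module_hom_def)
  have T_smult: "T (k \<odot>\<^bsub>V\<^esub> v) = k \<odot>\<^bsub>W\<^esub> T v" if "k \<in> carrier K" "v \<in> carrier V" for k v
    using f_hom that by (auto simp: module_hom_def)
  \<comment> \<open>The three claims share one induction because membership of the partial sum in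
    \<open>carrier V\<close> is what allows additivity of \<open>T\<close> and \<open>F i\<close> to
    be applied.\<close>
  have L_facts: "L a J \<in> carrier V \<and> T (L a J) = (\<Oplus>\<^bsub>W\<^esub>j\<in>J. a j \<odot>\<^bsub>W\<^esub> T (c j)) \<and>
      (\<forall>i\<in>I. F i (L a J) = (if i \<in> J then a i else \<zero>\<^bsub>K\<^esub>))"
    if "J \<subseteq> I" "a \<in> I \<rightarrow> carrier K" for J a
    using finite_subset[OF that(1) I] that(1)
  proof (induction J rule: finite_induct)
    case empty
    have "F i \<zero>\<^bsub>V\<^esub> = \<zero>\<^bsub>K\<^esub>" if "i \<in> I" for i
      using F_smult[of i "\<zero>\<^bsub>K\<^esub>" "\<zero>\<^bsub>V\<^esub>"] that by simp
    then show ?case by (simp add: L_def)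
  next
    case (insert j J)
    have [simp]: "a i \<in> carrier K" if "i \<in> I" for i
      using that \<open>a \<in> I \<rightarrow> carrier K\<close> by auto
    have j: "j \<in> I" "J \<subseteq> I" using insert by auto
    have "L a (insert j J) = a j \<odot>\<^bsub>V\<^esub> c j \<oplus>\<^bsub>V\<^esub> L a J"
      unfolding L_def using insert.hyps j by (intro V.module.M.finsum_insert) auto
    moreover have "(\<Oplus>\<^bsub>W\<^esub>i\<in>insert j J. a i \<odot>\<^bsub>W\<^esub> T (c i)) =
        a j \<odot>\<^bsub>W\<^esub> T (c j) \<oplus>\<^bsub>W\<^esub> (\<Oplus>\<^bsub>W\<^esub>i\<in>J. a i \<odot>\<^bsub>W\<^esub> T (c i))"
      using insert.hyps j by (intro W.module.M.finsum_insert) auto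
    ultimately show ?case
      using insert j by (auto simp: T_add T_smult F_add F_smult dual)
  qed
  have T_eq_iff: "T v = T w \<longleftrightarrow> (\<forall>i\<in>I. F i v = F i w)"
    if "v \<in> carrier V" "w \<in> carrier V" for v w
  proof -
    have d: "v = (v \<ominus>\<^bsub>V\<^esub> w) \<oplus>\<^bsub>V\<^esub> w" and dV: "v \<ominus>\<^bsub>V\<^esub> w \<in> carrier V"
      using that by (auto simp: a_minus_def V.module.M.a_assoc V.module.M.l_neg)
    have "T v = T (v \<ominus>\<^bsub>V\<^esub> w) \<oplus>\<^bsub>W\<^esub> T w"
      using T_add[OF dV that(2)] d by simp
    then have "T v = T w \<longleftrightarrow> T (v \<ominus>\<^bsub>V\<^esub> w) = \<zero>\<^bsub>W\<^esub>"
      using dV that by (simp add: W.module.M.show_r_zero W.module.M.show_l_zero)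
    moreover have "F i v = F i w \<longleftrightarrow> F i (v \<ominus>\<^bsub>V\<^esub> w) = \<zero>\<^bsub>K\<^esub>" if "i \<in> I" for i
    proof -
      have "F i v = F i (v \<ominus>\<^bsub>V\<^esub> w) \<oplus>\<^bsub>K\<^esub> F i w"
        using F_add[OF that dV \<open>w \<in> carrier V\<close>] d by simp
      then show ?thesis
        using dV that \<open>w \<in> carrier V\<close> by (simp add: V.module.R.show_l_zero)
    qed
    ultimately show ?thesis
      using kernel[OF dV] by simp
  qed
  show inj: "inj_on (\<lambda>i. T (c i)) I"
  proof (rule inj_onI)
    fix i j assume ij: "i \<in> I" "j \<in> I" "T (c i) = T (c j)"
    then have "F i (c i) = F i (c j)"
      using T_eq_iff by simp
    then show "i = j"
      using ij by (auto simp: dual split: if_splits)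
  qed
  let ?B = "(\<lambda>i. T (c i)) ` I"
  have B: "finite ?B" "?B \<subseteq> carrier W" using I by auto
  have lincomb: "W.module.lincomb a ?B = T (L (\<lambda>i. a (T (c i))) I)" if "a \<in> ?B \<rightarrow> carrier K" for a
  proof -
    have "W.module.lincomb a ?B = (\<Oplus>\<^bsub>W\<^esub>j\<in>I. a (T (c j)) \<odot>\<^bsub>W\<^esub> T (c j))"
      unfolding W.module.lincomb_def using that inj
      by (intro W.module.M.finsum_reindex) (auto intro!: W.module.smult_closed simp: Pi_iff)
    also have "\<dots> = T (L (\<lambda>i. a (T (c i))) I)"
      using L_facts[of I "\<lambda>i. a (T (c i))"] that by (simp add: Pi_iff)
    finally show ?thesis .
  qed
  have "W.module.lin_indpt ?B"
  proof (rule W.module.finite_lin_indpt2[OF B])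
    fix a assume a: "a \<in> ?B \<rightarrow> carrier K" and 0: "W.module.lincomb a ?B = \<zero>\<^bsub>W\<^esub>"
    have "(\<lambda>i. a (T (c i))) \<in> I \<rightarrow> carrier K" using a by (simp add: Pi_iff)
    from L_facts[OF order_refl this] 0 show "\<forall>v\<in>?B. a v = \<zero>\<^bsub>K\<^esub>"
      unfolding lincomb[OF a] by (subst (asm) kernel) auto
  qed
  moreover have "W.module.gen_set ?B"
  proof (intro equalityI W.module.span_is_subset2 B subsetI)
    fix w assume "w \<in> carrier W"
    then obtain v where v: "v \<in> carrier V" "w = T v" using surj by auto
    \<comment> \<open>\<open>lincomb\<close> takes coefficients indexed by vectors instead of
      elements of \<open>I\<close>; injectivity allows the index to be recovered.\<close>
    define a where "a u = F (the_inv_into I (\<lambda>i. T (c i)) u) v" for u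
    have a: "a (T (c i)) = F i v" if "i \<in> I" for i
      using the_inv_into_f_f[OF inj that] by (simp add: a_def)
    then have aK: "a \<in> ?B \<rightarrow> carrier K" using v by auto
    have a': "(\<lambda>i. a (T (c i))) \<in> I \<rightarrow> carrier K" using aK by (simp add: Pi_iff)
    have "w = W.module.lincomb a ?B"
      unfolding lincomb[OF aK] v(2) using L_facts[OF order_refl a'] v a
      by (subst T_eq_iff) auto
    then show "w \<in> W.module.span ?B"
      using B aK unfolding W.module.span_def by blast
  qed
  ultimately show "W.basis ?B"
    using B by (simp add: W.basis_def)
qed

text \<open>This supplies the surjection and the kernel for
  \<open>basis_image_if_dual_functionals\<close>, with \<open>N\<close> as the kernel.\<close>

lemma quotient_module_projection:
  assumes "vectorspace K M" and "submodule K N M"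
  shows "linear_map K M (quotient_module M N) (\<lambda>v. N +>\<^bsub>M\<^esub> v)"
    and "(\<lambda>v. N +>\<^bsub>M\<^esub> v) ` carrier M = carrier (quotient_module M N)"
    and "v \<in> carrier M \<Longrightarrow> N +>\<^bsub>M\<^esub> v = \<zero>\<^bsub>quotient_module M N\<^esub> \<longleftrightarrow> v \<in> N"
proof -
  interpret M: vectorspace K M by fact
  interpret N: submodule K N M by fact
  interpret Q: Module.module K "quotient_module M N"
    by (intro quotient_module_is_module M.module_axioms assms)
  have inv: "\<ominus>\<^bsub>M\<^esub> v = (\<ominus>\<^bsub>K\<^esub> \<one>\<^bsub>K\<^esub>) \<odot>\<^bsub>M\<^esub> v" if "v \<in> N" for v
    using that N.subset M.smult_l_minus[of "\<one>\<^bsub>K\<^esub>" v] by auto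
  have "subgroup N (add_monoid M)"
    using N.subset by unfold_locales (auto simp: inv simp flip: a_inv_def)
  then interpret N: abelian_subgroup N M
    by (intro abelian_subgroupI3 additive_subgroupI M.abelian_group_axioms)
  let ?T = "\<lambda>v. N +>\<^bsub>M\<^esub> v"
  show surj: "?T ` carrier M = carrier (quotient_module M N)"
    by (auto simp: quotient_module_def A_RCOSETS_def')
  have T_add: "?T (v \<oplus>\<^bsub>M\<^esub> w) = ?T v \<oplus>\<^bsub>quotient_module M N\<^esub> ?T w"
    if "v \<in> carrier M" "w \<in> carrier M" for v w
    using that by (simp add: quotient_module_def N.a_rcos_sum)
  have T_smult: "?T (a \<odot>\<^bsub>M\<^esub> v) = a \<odot>\<^bsub>quotient_module M N\<^esub> ?T v"
    if "a \<in> carrier K" "v \<in> carrier M" for a v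
  proof (intro equalityI subsetI)
    fix w assume "w \<in> ?T (a \<odot>\<^bsub>M\<^esub> v)"
    then obtain n where "n \<in> N" "w = n \<oplus>\<^bsub>M\<^esub> a \<odot>\<^bsub>M\<^esub> v"
      by (auto simp: a_r_coset_def')
    then show "w \<in> a \<odot>\<^bsub>quotient_module M N\<^esub> ?T v"
      using N.a_rcos_self[OF that(2)] by (auto simp: quotient_module_def set_add_def')
  next
    fix w assume "w \<in> a \<odot>\<^bsub>quotient_module M N\<^esub> ?T v"
    then obtain n n' where "n \<in> N" "n' \<in> N" "w = n \<oplus>\<^bsub>M\<^esub> a \<odot>\<^bsub>M\<^esub> (n' \<oplus>\<^bsub>M\<^esub> v)"
      by (auto simp: quotient_module_def set_add_def' a_r_coset_def')
    \<comment> \<open>The summand \<open>n\<close> comes from the extra \<open>N\<close> in the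
      scalar multiplication of the quotient; it merges with the scaled \<open>n'\<close> into a
      single element of \<open>N\<close>.\<close>
    then have "w = (n \<oplus>\<^bsub>M\<^esub> a \<odot>\<^bsub>M\<^esub> n') \<oplus>\<^bsub>M\<^esub> a \<odot>\<^bsub>M\<^esub> v" "n \<oplus>\<^bsub>M\<^esub> a \<odot>\<^bsub>M\<^esub> n' \<in> N"
      using that N.subset by (auto simp: M.smult_r_distr M.a_assoc subset_iff)
    then show "w \<in> ?T (a \<odot>\<^bsub>M\<^esub> v)"
      by (auto simp: a_r_coset_def')
  qed
  have "?T \<in> LinearCombinations.module_hom K M (quotient_module M N)"
    using surj by (auto simp: LinearCombinations.module_hom_def T_add T_smult)
  then show "linear_map K M (quotient_module M N) ?T"
    by (intro linear_map.intro mod_hom.intro mod_hom_axioms.intro vectorspace.intro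
        M.vectorspace_axioms M.module_axioms Q.module_axioms M.field_axioms)
  show "?T v = \<zero>\<^bsub>quotient_module M N\<^esub> \<longleftrightarrow> v \<in> N" if "v \<in> carrier M"
    using that N.a_rcos_self[OF that] N.a_rcos_const[of v] by (auto simp: quotient_module_def)
qed

section \<open>Dual functionals on restricted cocycles\<close>

context restricted_lie_algebra_2
begin

lemma H2_basis_if_dual_functionals:
  fixes F :: "'i \<Rightarrow> ('v \<Rightarrow> 'v \<Rightarrow> 'v) \<times> ('v \<Rightarrow> 'v) \<Rightarrow> 'a"
  assumes "finite I" and "\<And>i. i \<in> I \<Longrightarrow> c i \<in> cocycles2"
    and "\<And>i v w. i \<in> I \<Longrightarrow> F i (v \<oplus>\<^bsub>cochains2\<^esub> w) = F i v + F i w"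
    and "\<And>i k v. i \<in> I \<Longrightarrow> F i (k \<odot>\<^bsub>cochains2\<^esub> v) = k * F i v"
    and "\<And>i j. i \<in> I \<Longrightarrow> j \<in> I \<Longrightarrow> F i (c j) = (if i = j then 1 else 0)"
    and "\<And>v. v \<in> cocycles2 \<Longrightarrow> v \<in> coboundaries2 \<longleftrightarrow> (\<forall>i\<in>I. F i v = 0)"
  shows "vectorspace.basis class_ring H2 ((\<lambda>i. H2_class (c i)) ` I)"
    and "vectorspace.dim class_ring H2 = card I"
proof -
  let ?Z = "cochains2\<lparr>carrier := cocycles2\<rparr>"
  \<comment> \<open>Cosets depend only on the addition, which restricting the carrier leaves
    unchanged.\<close>
  have coset: "coboundaries2 +>\<^bsub>?Z\<^esub> v = H2_class v" for v
    by (simp add: H2_class_def a_r_coset_def')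
  have Z: "vectorspace class_ring ?Z"
    by (intro vectorspace.intro submodule.module[OF coboundaries2_submodule] class_field.field_axioms)
  note proj = quotient_module_projection[OF Z coboundaries2_submodule, folded H2_def, unfolded coset]
  interpret T: linear_map class_ring ?Z H2 H2_class by (rule proj(1))
  note basis = T.basis_image_if_dual_functionals[of I c F, OF assms(1) _ proj(2)]
  show "T.W.basis ((\<lambda>i. H2_class (c i)) ` I)"
    by (rule basis(2)) (use assms proj(3) in auto)
  have "inj_on (\<lambda>i. H2_class (c i)) I"
    by (rule basis(1)) (use assms proj(3) in auto)
  then show "T.W.dim = card I"
    using T.W.dim_basis[OF _ \<open>T.W.basis _\<close>] assms(1) by (simp add: card_image)
qed

end

section \<open>Coordinates of Heisenberg cochains\<close>

lemma heis_cochain_simps: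
  "fst (heis_cochain p q r d e f) heis_x heis_y = p"
  "fst (heis_cochain p q r d e f) heis_x heis_z = q"
  "fst (heis_cochain p q r d e f) heis_y heis_z = r"
  "snd (heis_cochain p q r d e f) heis_x = d"
  "snd (heis_cochain p q r d e f) heis_y = e"
  "snd (heis_cochain p q r d e f) heis_z = f"
  by (cases p; cases q; cases r; cases d; cases e; cases f;
      simp add: heis_cochain_def heis_x_def heis_y_def heis_z_def)+

lemma char_2_simps:
  fixes a b :: "'a::field"
  assumes "CHAR('a) = 2"
  shows "a - b = a + b" "a + (a + b) = b" "a + a = 0" "- a = a"
  using char_2_double[OF assms] char_2_minus[OF assms]
  by (metis diff_conv_add_uminus, metis add.assoc add_0, auto)

lemma char_2_sum_eq_0_iff:
  fixes a b :: "'a::field"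
  assumes "CHAR('a) = 2"
  shows "a + b = 0 \<longleftrightarrow> a = b"
  using char_2_simps[OF assms] by (metis add_cancel_right_right)

text \<open>The functional with index 2 is needed only for \<open>\<theta>(z) = 0\<close>: otherwise the \<open>z\<close>-component of
  \<open>\<omega>(z)\<close> can be removed by the coboundary of some \<open>\<psi>\<close> with \<open>\<psi>(z) = s z\<close>.\<close>

definition heis_H2_coords ::
    "nat \<Rightarrow> ('a::field heis \<Rightarrow> 'a heis \<Rightarrow> 'a heis) \<times> ('a heis \<Rightarrow> 'a heis) \<Rightarrow> 'a" where
  "heis_H2_coords i = (\<lambda>(\<phi>, \<omega>).
     [fst (\<phi> heis_x heis_y) + snd (snd (\<phi> heis_y heis_z)),
      fst (snd (\<phi> heis_x heis_y)) + snd (snd (\<phi> heis_x heis_z)),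
      snd (snd (\<omega> heis_z))] ! i)"

lemma heis_H2_coords_cochain:
  "heis_H2_coords 0 (heis_cochain p q r d e f) = fst p + snd (snd r)"
  "heis_H2_coords (Suc 0) (heis_cochain p q r d e f) = fst (snd p) + snd (snd q)"
  "heis_H2_coords (Suc (Suc 0)) (heis_cochain p q r d e f) = snd (snd f)"
  by (simp_all add: heis_H2_coords_def case_prod_unfold heis_cochain_simps)

section \<open>Cocycles and coboundaries when \<theta> vanishes on x and y\<close>

context
  fixes \<theta> :: "'a::field heis \<Rightarrow> 'a" and t :: 'a
  assumes char: "CHAR('a) = 2"
    and \<theta>: "\<theta> heis_x = 0" "\<theta> heis_y = 0" "\<theta> heis_z = t"
begin

interpretation heis: restricted_lie_algebra_2 heis_scale heis_bracket "heis_sq \<theta>"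
  by (rule heis_restricted_lie_algebra[OF char])

text \<open>All equations come from the condition involving the 2-map, evaluated at pairs of basis
  vectors. The Chevalley-Eilenberg condition at x, y, z amounts to \<open>q1 + r2 = 0\<close>, which
  these equations imply.\<close>

lemma heis_cocycle_iff:
  "heis_cochain (p1, p2, p3) (q1, q2, q3) (r1, r2, r3) (d1, d2, d3) (e1, e2, e3) (f1, f2, f3)
      \<in> heis.cocycles2 \<longleftrightarrow>
    q1 = 0 \<and> q2 = 0 \<and> r1 = 0 \<and> r2 = 0 \<and> d1 = p2 + q3 \<and> d2 = 0 \<and> e1 = 0 \<and> e2 = p1 + r3 \<and>
    f1 = t * r3 \<and> f2 = t * q3"
  (is "?c \<in> _ \<longleftrightarrow> ?R")
proof
  assume c: "?c \<in> heis.cocycles2"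
  let ?\<phi> = "fst ?c" and ?\<omega> = "snd ?c"
  have *: "?\<phi> u (heis_sq \<theta> v) + heis_bracket u (?\<omega> v) + heis_bracket (?\<phi> u v) v
      + ?\<phi> (heis_bracket u v) v = 0" for u v
    using c unfolding heis.cocycles2_def by (auto simp: case_prod_unfold simp del: split_paired_All)
  \<comment> \<open>The pair (y, x) yields \<open>q1 = q2 = 0\<close> and
    \<open>d1 = p2 + q3\<close>, and (x, y) yields \<open>r1 = r2 = 0\<close> and
    \<open>e2 = p1 + r3\<close>. The diagonal pairs yield \<open>d2 = 0\<close> and
    \<open>e1 = 0\<close>; (x, z) and (y, z) determine \<open>f2\<close> and
    \<open>f1\<close>.\<close>
  show ?R
    using *[of heis_x heis_x] *[of heis_x heis_y] *[of heis_x heis_z]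
      *[of heis_y heis_x] *[of heis_y heis_y] *[of heis_y heis_z]
      *[of heis_z heis_x] *[of heis_z heis_y]
    by (simp add: heis_cochain_def heis_x_def heis_y_def heis_z_def zero_prod_def
        \<theta>[unfolded heis_x_def heis_y_def heis_z_def] char_2_simps[OF char]
        char_2_sum_eq_0_iff[OF char] add_ac)
next
  assume R: ?R
  have "?c \<in> carrier heis.cochains2"
    using heis_cochain_unique[OF char] by (metis surj_pair)
  with R show "?c \<in> heis.cocycles2"
    unfolding heis.cocycles2_def
    by (auto simp: heis_cochain_def heis_z_def \<theta>[unfolded heis_z_def] \<theta>
        zero_prod_def char_2_simps[OF char] algebra_simps power2_eq_square)
qed

text \<open>Let \<open>\<psi>(z) = (z1, z2, z3)\<close>. The coboundary of \<psi> takes (x, y) to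
  \<open>\<psi>(z)\<close> modulo z, (x, z) to \<open>z2\<close> times z and (y, z) to
  \<open>z1\<close> times z, which forces \<open>p1 = r3\<close> and \<open>p2 = q3\<close>. Its
  \<omega> takes z to \<open>t\<close> times \<open>\<psi>(z)\<close>, so \<open>f3 = t * z3\<close>
  is an obstruction only for \<open>t = 0\<close>.\<close>

lemma heis_coboundary_iff:
  assumes "heis_cochain (p1, p2, p3) (0, 0, q3) (0, 0, r3) d e (f1, f2, f3) \<in> heis.cocycles2"
    (is "?c \<in> _")
  shows "?c \<in> heis.coboundaries2 \<longleftrightarrow> p1 = r3 \<and> p2 = q3 \<and> (t = 0 \<longrightarrow> f3 = 0)"
proof -
  obtain d1 d2 d3 e1 e2 e3 where de: "d = (d1, d2, d3)" "e = (e1, e2, e3)"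
    by (cases d, cases e)
  have Z: "d1 = p2 + q3" "d2 = 0" "e1 = 0" "e2 = p1 + r3" "f1 = t * r3" "f2 = t * q3"
    using assms unfolding de heis_cocycle_iff by auto
  have "p1 = r3 \<and> p2 = q3 \<and> (t = 0 \<longrightarrow> f3 = 0)" if "?c \<in> heis.coboundaries2"
  proof -
    from that obtain \<psi>
      where \<psi>: "?c = (heis.d1_CE \<psi>, \<lambda>u. heis_bracket (\<psi> u) u + \<psi> (heis_sq \<theta> u))"
      and lin: "Vector_Spaces.linear heis_scale heis_scale \<psi>"
      by (auto simp: heis.coboundaries2_def)
    have \<psi>0: "\<psi> (0, 0, 0) = (0, 0, 0)"
      using lin unfolding heis_linear_iff by (metis heis_scale.simps mult_zero_left prod_cases3)
    obtain z1 z2 z3 where z: "\<psi> (0, 0, 1) = (z1, z2, z3)" by (cases "\<psi> (0, 0, 1)")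
    obtain y1 y2 y3 where y: "\<psi> (0, 1, 0) = (y1, y2, y3)" by (cases "\<psi> (0, 1, 0)")
    obtain x1 x2 x3 where x: "\<psi> (1, 0, 0) = (x1, x2, x3)" by (cases "\<psi> (1, 0, 0)")
    have "\<psi> (0, 0, t) = heis_scale t (\<psi> (0, 0, 1))"
      using lin unfolding heis_linear_iff by (metis heis_scale.simps mult_zero_right mult_1_right)
    then have zt: "\<psi> (0, 0, t) = (t * z1, t * z2, t * z3)" by (simp add: z)
    note v = heis_cochain_simps[of "(p1, p2, p3)" "(0, 0, q3)" "(0, 0, r3)" d e "(f1, f2, f3)",
        unfolded \<psi>]
    show ?thesis
      using v(1-3) v(6)
      by (auto simp: heis.d1_CE_def heis_x_def heis_y_def heis_z_def x y z zt \<psi>0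
          \<theta>[unfolded heis_x_def heis_y_def heis_z_def] char_2_simps[OF char])
  qed
  moreover have "?c \<in> heis.coboundaries2" if R: "p1 = r3 \<and> p2 = q3 \<and> (t = 0 \<longrightarrow> f3 = 0)"
  proof -
    \<comment> \<open>for \<open>t = 0\<close> this is the junk value \<open>0\<close>, and any value would do\<close>
    define s where "s = f3 / t"
    have s: "f3 = t * s" using R by (auto simp: s_def)
    \<comment> \<open>Here \<open>\<psi>(z) = (p1, p2, s)\<close> matches \<open>f3 = t * s\<close>.
      The entries \<open>d3\<close> and \<open>e3\<close> produce the z-components of
      \<open>\<omega>(x)\<close> and \<open>\<omega>(y)\<close>. In \<open>p3 + s\<close>, the
      \<open>s\<close> cancels the one that \<open>\<psi>(z)\<close> adds to the z-component of
      \<open>\<phi>(x,y)\<close>.\<close>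
    define \<psi> :: "'a heis \<Rightarrow> 'a heis" where
      "\<psi> = (\<lambda>(a, b, c). (a * (p3 + s) + b * e3 + c * p1, a * d3 + c * p2, c * s))"
    have "Vector_Spaces.linear heis_scale heis_scale \<psi>"
      by (auto simp: heis_linear_iff \<psi>_def algebra_simps)
    moreover have "?c = (heis.d1_CE \<psi>, \<lambda>u. heis_bracket (\<psi> u) u + \<psi> (heis_sq \<theta> u))"
      using R Z unfolding de
      by (auto simp: fun_eq_iff heis_cochain_def heis.d1_CE_def \<psi>_def s heis_z_def
          \<theta>[unfolded heis_z_def] \<theta> char_2_simps[OF char] algebra_simps power2_eq_square)
    ultimately show ?thesis
      unfolding heis.coboundaries2_def by blast
  qed
  ultimately show ?thesis ..
qed

lemma heis_cocycle_cases:
  assumes "v \<in> heis.cocycles2"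
  obtains p1 p2 p3 q3 r3 d e f1 f2 f3
  where "v = heis_cochain (p1, p2, p3) (0, 0, q3) (0, 0, r3) d e (f1, f2, f3)"
proof -
  have "v \<in> carrier heis.cochains2"
    using assms by (auto simp: heis.cocycles2_def)
  then obtain p q r d e f where v: "v = heis_cochain p q r d e f"
    using heis_cochain_unique[OF char] by (cases v) blast
  show ?thesis
    using assms that unfolding v
    by (cases p; cases q; cases r; cases d; cases e; cases f) (auto simp: heis_cocycle_iff)
qed

text \<open>Both restricted structures are covered at once. The functional with index 2 reads off
  \<open>f3\<close>, and \<open>heis_coboundary_iff\<close> requires \<open>f3 = 0\<close> exactly
  when \<open>t = 0\<close>, so only \<open>n\<close> depends on the case.\<close>

lemma heis_H2_basis:
  assumes n: "n = (if t = 0 then 3 else 2)"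
    and c: "\<And>i. i < n \<Longrightarrow> c i \<in> heis.cocycles2"
    and dual: "\<And>i j. i < n \<Longrightarrow> j < n \<Longrightarrow> heis_H2_coords i (c j) = (if i = j then 1 else 0)"
  shows "vectorspace.basis class_ring (heis_H2 \<theta>) ((\<lambda>i. heis_H2_class \<theta> (c i)) ` {..<n})"
    and "vectorspace.dim class_ring (heis_H2 \<theta>) = n"
proof -
  have n': "i < n \<longleftrightarrow> i = 0 \<or> i = Suc 0 \<or> t = 0 \<and> i = Suc (Suc 0)" for i
    using n by auto
  have add: "heis_H2_coords i (v \<oplus>\<^bsub>heis.cochains2\<^esub> w) = heis_H2_coords i v + heis_H2_coords i w"
    if "i < n" for i v w
    using that unfolding n'
    by (cases v; cases w) (auto simp: heis_H2_coords_def heis.cochains2_def)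
  have smult: "heis_H2_coords i (k \<odot>\<^bsub>heis.cochains2\<^esub> v) = k * heis_H2_coords i v"
    if "i < n" for i k v
  proof -
    have "fst (heis_scale k u) = k * fst u" "fst (snd (heis_scale k u)) = k * fst (snd u)"
      "snd (snd (heis_scale k u)) = k * snd (snd u)" for u
      by (cases u; simp)+
    then show ?thesis
      using that unfolding n'
      by (cases v) (auto simp: heis_H2_coords_def heis.cochains2_def distrib_left)
  qed
  have kernel: "v \<in> heis.coboundaries2 \<longleftrightarrow> (\<forall>i\<in>{..<n}. heis_H2_coords i v = 0)"
    if "v \<in> heis.cocycles2" for v
    using that
  proof (cases v rule: heis_cocycle_cases)
    case 1
    have "(\<forall>i\<in>{..<n}. P i) \<longleftrightarrow> P 0 \<and> P (Suc 0) \<and> (t = 0 \<longrightarrow> P (Suc (Suc 0)))" for P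
      by (auto simp: n')
    with 1 that show ?thesis
      by (simp add: heis_coboundary_iff heis_H2_coords_cochain char_2_sum_eq_0_iff[OF char])
  qed
  note basis = heis.H2_basis_if_dual_functionals[of "{..<n}" c heis_H2_coords]
  show "vectorspace.basis class_ring heis.H2 ((\<lambda>i. heis.H2_class (c i)) ` {..<n})"
    by (rule basis(1)) (use c dual add smult kernel in auto)
  have "vectorspace.dim class_ring heis.H2 = card {..<n}"
    by (rule basis(2)) (use c dual add smult kernel in auto)
  then show "vectorspace.dim class_ring heis.H2 = n" by simp
qed

end

section \<open>The cases \<theta> = 0 and \<theta> = z^*\<close>

theorem theorem5p29:
  assumes "CHAR('a::alg_closed_field) = 2"
  shows "vectorspace.dim class_ring (heis_H2 (\<lambda>_. 0 :: 'a)) = 3 \<and>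
    vectorspace.dim class_ring (heis_H2 (heis_z_dual :: 'a heis \<Rightarrow> 'a)) = 2 \<and>
    vectorspace.basis class_ring (heis_H2 (\<lambda>_. 0 :: 'a))
      {heis_H2_class (\<lambda>_. 0) (heis_cochain 0 0 heis_z 0 heis_y 0),
       heis_H2_class (\<lambda>_. 0) (heis_cochain 0 heis_z 0 heis_x 0 0),
       heis_H2_class (\<lambda>_. 0) (heis_cochain 0 0 0 0 0 heis_z)} \<and>
    vectorspace.basis class_ring (heis_H2 (heis_z_dual :: 'a heis \<Rightarrow> 'a))
      {heis_H2_class heis_z_dual (heis_cochain heis_x 0 0 0 heis_y 0),
       heis_H2_class heis_z_dual (heis_cochain heis_y 0 0 heis_x 0 0)}"
proof -
  \<comment> \<open>The order follows the functionals: the entries of \<open>?c0\<close> have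
    \<open>r3 = 1\<close>, \<open>q3 = 1\<close> and \<open>f3 = 1\<close> respectively, and those
    of \<open>?c1\<close> have \<open>p1 = 1\<close> and \<open>p2 = 1\<close>. The nonzero values
    of \<omega> at x and y are the ones forced by \<open>d1 = p2 + q3\<close> and
    \<open>e2 = p1 + r3\<close>.\<close>
  let ?c0 = "\<lambda>i. [heis_cochain 0 0 heis_z 0 heis_y 0, heis_cochain 0 heis_z 0 heis_x 0 0,
    heis_cochain 0 0 0 0 0 heis_z :: ('a heis \<Rightarrow> _) \<times> _] ! i"
  let ?c1 = "\<lambda>i. [heis_cochain heis_x 0 0 0 heis_y 0,
    heis_cochain heis_y 0 0 heis_x 0 0 :: ('a heis \<Rightarrow> _) \<times> _] ! i"
  have \<theta>: "heis_z_dual heis_x = (0 :: 'a)" "heis_z_dual heis_y = (0 :: 'a)"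
    "heis_z_dual heis_z = (1 :: 'a)"
    by (simp_all add: heis_x_def heis_y_def heis_z_def)
  note b0 = heis_H2_basis[of "\<lambda>_. 0" 0 3 ?c0, OF assms]
  note b1 = heis_H2_basis[of heis_z_dual 1 2 ?c1, OF assms \<theta>]
  note defs = heis_x_def heis_y_def heis_z_def zero_prod_def
    heis_H2_coords_cochain less_Suc_eq numeral_2_eq_2 numeral_3_eq_3
    heis_cocycle_iff[OF assms, of "\<lambda>_. 0" 0] heis_cocycle_iff[OF assms \<theta>]
  have "vectorspace.basis class_ring (heis_H2 (\<lambda>_. 0 :: 'a))
      ((\<lambda>i. heis_H2_class (\<lambda>_. 0) (?c0 i)) ` {..<3})"
    by (rule b0(1)) (auto simp: defs)
  moreover have "vectorspace.dim class_ring (heis_H2 (\<lambda>_. 0 :: 'a)) = 3"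
    by (rule b0(2)) (auto simp: defs)
  moreover have "vectorspace.basis class_ring (heis_H2 (heis_z_dual :: 'a heis \<Rightarrow> 'a))
      ((\<lambda>i. heis_H2_class heis_z_dual (?c1 i)) ` {..<2})"
    by (rule b1(1)) (auto simp: defs)
  moreover have "vectorspace.dim class_ring (heis_H2 (heis_z_dual :: 'a heis \<Rightarrow> 'a)) = 2"
    by (rule b1(2)) (auto simp: defs)
  ultimately show ?thesis
    by (simp add: numeral_2_eq_2 numeral_3_eq_3 lessThan_Suc insert_commute)
qed

end
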